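(* Let $G$ be a connected graph of order $n\ge 2$ and let $H$ be an arbitrary graph of order at least $2$. Suppose that (i) for each adjacency basis of $H$ there exists a vertex of $H$ with adjacency representation entirely $2$ with respect to it, and (ii) there exists an adjacency basis $W$ of $H$ such that no vertex of $H$ has adjacency representation entirely $1$ with respect to $W$. Then $\beta(G[H])=n\,\beta_2(H)+b(G)-\iota_{N}(G)$.
   Context: All graphs are finite and simple; $u\sim v$ means that $u,v$ are adjacent. For a connected graph $X$, an ordered set $W=\{w_1,\dots,w_k\}\subseteq V(X)$ is a resolving set if the vectors $(d_X(v,w_1),\dots,d_X(v,w_k))$, $v\in V(X)$, are pairwise distinct ($d_X$ is the graph distance); the metric dimension $\beta(X)$ is the minimum cardinality of a resolving set of $X$. For any graph $H$ and vertices $v,w$, set $a_H(v,w)=0$ if $v=w$, $a_H(v,w)=1$ if $v\sim w$, and $a_H(v,w)=2$ if $v\ne w$ and $v\nsim w$. For an ordered set $W=\{w_1,\dots,w_k\}\subseteq V(H)$ the adjacency representation of $v$ with respect to $W$ is $r_2(v|W)=(a_H(v,w_1),\dots,a_H(v,w_k))$; it is entirely $i$ if all its entries equal $i$. $W$ is an adjacency resolving set of $H$ if distinct vertices of $H$ have distinct adjacency representations with respect to $W$; the adjacency metric dimension $\beta_2(H)$ is the minimum cardinality of an adjacency resolving set, and an adjacency basis of $H$ is an adjacency resolving set of cardinality $\beta_2(H)$. The lexicographic product $G[H]$ has vertex set $V(G)\times V(H)$, with $(v,u)$ and $(v',u')$ adjacent iff $v\sim v'$ in $G$, or $v=v'$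 and $u\sim u'$ in $H$. Two distinct vertices $u,v$ of $G$ are twins if $N(v)\setminus\{u\}=N(u)\setminus\{v\}$, where $N(x)$ is the set of neighbors of $x$; the relation $u\equiv v$ iff $u=v$ or $u,v$ are twins is an equivalence relation on $V(G)$, each of whose classes is a clique or an independent set. A class is of type (N) if it is an independent set of size at least $2$. $\iota_N(G)$ is the number of classes of type (N), and $b(G)$ is the total number of vertices lying in classes of type (N) (equivalently, the number of vertices having a non-adjacent twin). *)

theory Defs
  imports "Graph_Theory.Graph_Theory"
begin

text \<open>
  A finite simple graph is a \<open>pair_graph\<close>: a finite loop-free digraph on \<open>pverts X\<close> whose arc set
  \<open>parcs X\<close> is symmetric, so that \<open>u \<sim> v\<close> is \<open>(u, v) \<in> parcs X\<close>. Ordered sets are distinct lists.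
\<close>

text \<open>The graph distance is the cost of a shortest walk for unit arc weights.\<close>

definition graph_dist :: "'a pair_pre_digraph \<Rightarrow> 'a \<Rightarrow> 'a \<Rightarrow> ereal" where
  "graph_dist X u v = wf_digraph.\<mu> (with_proj X) (\<lambda>_. 1) u v"

definition resolving_set :: "'a pair_pre_digraph \<Rightarrow> 'a list \<Rightarrow> bool" where
  "resolving_set X W \<longleftrightarrow> distinct W \<and> set W \<subseteq> pverts X \<and>
     inj_on (\<lambda>v. map (graph_dist X v) W) (pverts X)"

definition metric_dimension :: "'a pair_pre_digraph \<Rightarrow> nat" where
  "metric_dimension X = (LEAST k. \<exists>W. resolving_set X W \<and> length W = k)"

definition adj_dist :: "'a pair_pre_digraph \<Rightarrow> 'a \<Rightarrow> 'a \<Rightarrow> nat" where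
  "adj_dist H v w = (if v = w then 0 else if (v, w) \<in> parcs H then 1 else 2)"

definition adj_rep :: "'a pair_pre_digraph \<Rightarrow> 'a \<Rightarrow> 'a list \<Rightarrow> nat list" where
  "adj_rep H v W = map (adj_dist H v) W"

definition entirely :: "nat \<Rightarrow> nat list \<Rightarrow> bool" where
  "entirely i r \<longleftrightarrow> (\<forall>x \<in> set r. x = i)"

definition adj_resolving_set :: "'a pair_pre_digraph \<Rightarrow> 'a list \<Rightarrow> bool" where
  "adj_resolving_set H W \<longleftrightarrow> distinct W \<and> set W \<subseteq> pverts H \<and>
     inj_on (\<lambda>v. adj_rep H v W) (pverts H)"

definition adj_metric_dimension :: "'a pair_pre_digraph \<Rightarrow> nat" where
  "adj_metric_dimension H = (LEAST k. \<exists>W. adj_resolving_set H W \<and> length W = k)"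

definition adj_basis :: "'a pair_pre_digraph \<Rightarrow> 'a list \<Rightarrow> bool" where
  "adj_basis H W \<longleftrightarrow> adj_resolving_set H W \<and> length W = adj_metric_dimension H"

definition lex_product ::
    "'a pair_pre_digraph \<Rightarrow> 'b pair_pre_digraph \<Rightarrow> ('a \<times> 'b) pair_pre_digraph" where
  "lex_product G H =
     \<lparr> pverts = pverts G \<times> pverts H,
       parcs = {((v, u), (v', u')).
          v \<in> pverts G \<and> v' \<in> pverts G \<and> u \<in> pverts H \<and> u' \<in> pverts H \<and>
          ((v, v') \<in> parcs G \<or> v = v' \<and> (u, u') \<in> parcs H)} \<rparr>"

definition nbrs :: "'a pair_pre_digraph \<Rightarrow> 'a \<Rightarrow> 'a set" where
  "nbrs G x = {y. (x, y) \<in> parcs G}"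

definition twins :: "'a pair_pre_digraph \<Rightarrow> 'a \<Rightarrow> 'a \<Rightarrow> bool" where
  "twins G u v \<longleftrightarrow> u \<noteq> v \<and> nbrs G v - {u} = nbrs G u - {v}"

definition twin_rel :: "'a pair_pre_digraph \<Rightarrow> 'a rel" where
  "twin_rel G = {(u, v). u \<in> pverts G \<and> v \<in> pverts G \<and> (u = v \<or> twins G u v)}"

definition independent :: "'a pair_pre_digraph \<Rightarrow> 'a set \<Rightarrow> bool" where
  "independent G S \<longleftrightarrow> (\<forall>u \<in> S. \<forall>v \<in> S. (u, v) \<notin> parcs G)"

definition N_classes :: "'a pair_pre_digraph \<Rightarrow> 'a set set" where
  "N_classes G = {C \<in> pverts G // twin_rel G. independent G C \<and> card C \<ge> 2}"

definition iota_N :: "'a pair_pre_digraph \<Rightarrow> nat" where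
  "iota_N G = card (N_classes G)"

definition b_num :: "'a pair_pre_digraph \<Rightarrow> nat" where
  "b_num G = card (\<Union> (N_classes G))"

end

theory Submission
  imports Defs
begin

text \<open>
  Write \<open>L = G[H]\<close> and call \<open>{v} \<times> V(H)\<close> the layer of \<open>v\<close>. Seen from outside, all vertices of a
  layer look alike, so two vertices of one layer can only be told apart by landmarks in that layer;
  there the distance in \<open>L\<close> is the adjacency distance of \<open>H\<close>, because \<open>v\<close> has a neighbour in \<open>G\<close>
  through which any two vertices of the layer are joined. Every slice \<open>A `` {v}\<close> of a resolving set
  \<open>A\<close> must therefore be adjacency resolving for \<open>H\<close>, which already costs \<open>\<beta>\<^sub>2(H)\<close> landmarks per
  layer. Vertices in the layers of two non-twins are then separated by any landmark over a third
  vertex of \<open>G\<close> adjacent to exactly one of the two. For twins \<open>v, v'\<close> all landmarks outside their two layers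
  are useless, and a landmark of one layer sees the whole other layer at the constant distance 1 (adjacent
  twins) or 2 (non-adjacent twins). Hence a pair is left unseparated exactly when both slices admit a
  vertex whose representation is entirely 1, respectively entirely 2. This is the criterion
  \<open>separates_lex_product_iff\<close>.

  By (i), a slice of the minimum size \<open>\<beta>\<^sub>2(H)\<close> always admits an entirely 2 vertex. So in each class of
  non-adjacent twins all slices but at most one need an extra landmark, which gives the lower bound.
  Conversely the basis \<open>W\<close> of (ii) causes no conflict between adjacent twins. Adding to \<open>W\<close> its
  entirely 2 vertex \<open>z\<close>, which is unique because \<open>W\<close> is resolving, destroys the last conflict: \<open>z\<close> now has
  a zero entry. Using this enlarged set over all but one vertex of each class, and \<open>W\<close> elsewhere, attains
  the bound; the number of extra landmarks is \<open>b(G) - \<iota>\<^sub>N(G)\<close>.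
\<close>

section \<open>Distances in graphs\<close>

lemma (in pair_wf_digraph) graph_dist_eq_INF_length:
  "graph_dist G u v = (INF p\<in>{p. awalk u p v}. ereal (length p))"
proof -
  have "awalk_cost (\<lambda>_. 1) p = length p" for p
    by (induct p) auto
  then show ?thesis
    unfolding graph_dist_def \<mu>_def by simp
qed

text \<open>
  A set \<open>S\<close> whose members have the same neighbours outside \<open>S\<close> (a module) cannot be told apart from
  outside: a walk from \<open>x\<close> must leave \<open>S\<close> at some point, and a walk from \<open>y\<close> may jump straight to the
  vertex it first reaches outside. Layers of a lexicographic product, and unions of two layers over
  twins, are modules; this spares any computation of distances between distant layers.
\<close>

lemma (in pair_wf_digraph) graph_dist_module:
  assumes module: "\<And>x y w. x \<in> S \<Longrightarrow> y \<in> S \<Longrightarrow> w \<notin> S \<Longrightarrow> (x, w) \<in> parcs G \<Longrightarrow> (y, w) \<in> parcs G"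
    and "x \<in> S" "y \<in> S" "w \<notin> S"
  shows "graph_dist G x w = graph_dist G y w"
proof -
  have reroute: "\<exists>q. awalk b q w \<and> length q \<le> length p"
    if "awalk a p w" "a \<in> S" "b \<in> S" for a b p
    using that
  proof (induct p arbitrary: a)
    case Nil
    then show ?case using \<open>w \<notin> S\<close> by (auto simp: awalk_Nil_iff)
  next
    case (Cons e p)
    then have e: "e \<in> parcs G" "a = fst e" "awalk (snd e) p w"
      by (auto simp: awalk_Cons_iff)
    show ?case
    proof (cases "snd e \<in> S")
      case True
      then obtain q where "awalk b q w" "length q \<le> length p"
        using Cons e by blast
      then show ?thesis by (intro exI[of _ q]) simp
    next
      case False
      then have "(b, snd e) \<in> parcs G"
        using module[of a b "snd e"] Cons.prems e by simp
      then show ?thesis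
        using e by (intro exI[of _ "(b, snd e) # p"]) (simp add: awalk_Cons_iff)
    qed
  qed
  have "graph_dist G b w \<le> graph_dist G a w" if ab: "a \<in> S" "b \<in> S" for a b
    unfolding graph_dist_eq_INF_length
  proof (rule INF_mono)
    fix p assume "p \<in> {p. awalk a p w}"
    then obtain q where "awalk b q w" "length q \<le> length p"
      using reroute[of a p b] ab by auto
    then show "\<exists>q\<in>{p. awalk b p w}. ereal (length q) \<le> ereal (length p)"
      by auto
  qed
  then show ?thesis
    using assms(2,3) by (simp add: antisym)
qed

lemma (in pair_wf_digraph) adj_dist_le_graph_dist:
  "ereal (adj_dist G x w) \<le> graph_dist G x w"
  unfolding graph_dist_eq_INF_length
proof (rule INF_greatest)
  fix p assume "p \<in> {p. awalk x p w}"
  then have p: "awalk x p w" by simp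
  consider "p = []" | e where "p = [e]" | e f q where "p = e # f # q"
    by (metis list.exhaust)
  then have "adj_dist G x w \<le> length p"
    using p by cases (auto simp: awalk_simps adj_dist_def)
  then show "ereal (adj_dist G x w) \<le> ereal (length p)" by simp
qed

lemma (in pair_wf_digraph) graph_dist_le_length:
  "awalk x p w \<Longrightarrow> graph_dist G x w \<le> ereal (length p)"
  unfolding graph_dist_eq_INF_length by (rule INF_lower) simp

text \<open>The adjacency distance is the graph distance truncated at 2, so the two agree on vertices
  joined by a walk of length at most 2.\<close>

lemma (in pair_wf_digraph) graph_dist_eq_adj_dist:
  assumes "x \<in> pverts G"
    and "x = w \<or> (x, w) \<in> parcs G \<or> (\<exists>z. (x, z) \<in> parcs G \<and> (z, w) \<in> parcs G)"
  shows "graph_dist G x w = ereal (adj_dist G x w)"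
proof (rule antisym[OF _ adj_dist_le_graph_dist])
  consider "x = w" | "x \<noteq> w" "(x, w) \<in> parcs G"
    | z where "x \<noteq> w" "(x, w) \<notin> parcs G" "(x, z) \<in> parcs G" "(z, w) \<in> parcs G"
    using assms(2) by blast
  then show "graph_dist G x w \<le> ereal (adj_dist G x w)"
  proof cases
    case 1
    then show ?thesis
      using graph_dist_le_length[of x "[]" w] assms(1) by (simp add: awalk_simps adj_dist_def)
  next
    case 2
    then show ?thesis
      using graph_dist_le_length[of x "[(x, w)]" w] in_arcsD2
      by (simp add: awalk_simps adj_dist_def)
  next
    case 3
    then show ?thesis
      using graph_dist_le_length[of x "[(x, z), (z, w)]" w] in_arcsD2
      by (simp add: awalk_simps adj_dist_def)
  qed
qed

lemma (in pair_wf_digraph) graph_dist_eq_1_iff: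
  assumes "x \<noteq> w"
  shows "graph_dist G x w = 1 \<longleftrightarrow> (x, w) \<in> parcs G"
proof
  assume "graph_dist G x w = 1"
  then show "(x, w) \<in> parcs G"
    using adj_dist_le_graph_dist[of x w] assms
    by (auto simp: adj_dist_def one_ereal_def split: if_splits)
next
  assume "(x, w) \<in> parcs G"
  then show "graph_dist G x w = 1"
    using graph_dist_eq_adj_dist[of x w] in_arcsD1 assms
    by (auto simp: adj_dist_def one_ereal_def)
qed

lemma adj_dist_commute: "pair_graph H \<Longrightarrow> adj_dist H u v = adj_dist H v u"
proof -
  assume "pair_graph H"
  then interpret pair_graph H .
  show ?thesis by (auto simp: adj_dist_def dest: arcs_symmetric)
qed

lemma ex_neighbour_if_connected:
  assumes "pair_graph G" "Digraph_Component.connected (with_proj G)"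
    and "card (pverts G) \<ge> 2" and v: "v \<in> pverts G"
  shows "\<exists>w. (v, w) \<in> parcs G"
proof -
  interpret pair_graph G by fact
  have "\<not> pverts G \<subseteq> {v}"
    using assms(3) card_mono[of "{v}" "pverts G"] by auto
  then obtain w where w: "w \<in> pverts G" "w \<noteq> v" by auto
  have "v \<rightarrow>\<^sup>*\<^bsub>with_proj (mk_symmetric G)\<^esub> w"
    using assms(2) v w by (simp add: connected_def strongly_connected_def)
  then have "v \<rightarrow>\<^sup>*\<^bsub>with_proj G\<^esub> w"
    using reachable_mk_symmetric_eq[OF sym_arcs] by simp
  then obtain p where "awalk v p w" by (auto simp: reachable_awalk)
  then show ?thesis
    using w by (cases p) (auto simp: awalk_simps)
qed

section \<open>Separating sets\<close>

text \<open>
  The order of the landmarks is irrelevant, and all counting below is done with sets; this predicate is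
  the common unordered form of resolving and adjacency resolving sets.
\<close>

definition separates :: "('a \<Rightarrow> 'b \<Rightarrow> 'c) \<Rightarrow> 'a set \<Rightarrow> 'b set \<Rightarrow> bool" where
  "separates d V A \<longleftrightarrow> (\<forall>x\<in>V. \<forall>y\<in>V. x \<noteq> y \<longrightarrow> (\<exists>w\<in>A. d x w \<noteq> d y w))"

lemma separatesD:
  "separates d V A \<Longrightarrow> x \<in> V \<Longrightarrow> y \<in> V \<Longrightarrow> (\<And>w. w \<in> A \<Longrightarrow> d x w = d y w) \<Longrightarrow> x = y"
  unfolding separates_def by blast

lemma separates_mono: "separates d V A \<Longrightarrow> A \<subseteq> B \<Longrightarrow> separates d V B"
  unfolding separates_def by blast

lemma inj_on_map_iff_separates: "inj_on (\<lambda>v. map (d v) W) V \<longleftrightarrow> separates d V (set W)"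
  unfolding inj_on_def separates_def map_eq_conv by blast

lemma resolving_set_iff:
  "resolving_set X W \<longleftrightarrow>
     distinct W \<and> set W \<subseteq> pverts X \<and> separates (graph_dist X) (pverts X) (set W)"
  unfolding resolving_set_def inj_on_map_iff_separates ..

lemma adj_resolving_set_iff:
  "adj_resolving_set X W \<longleftrightarrow>
     distinct W \<and> set W \<subseteq> pverts X \<and> separates (adj_dist X) (pverts X) (set W)"
  unfolding adj_resolving_set_def adj_rep_def inj_on_map_iff_separates ..

lemma entirely_adj_rep_iff: "entirely i (adj_rep H v W) \<longleftrightarrow> (\<forall>w\<in>set W. adj_dist H v w = i)"
  unfolding entirely_def adj_rep_def by auto

lemma metric_dimension_eqI:
  assumes "finite (pverts X)"
    and "A \<subseteq> pverts X" "separates (graph_dist X) (pverts X) A" "card A = k"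
    and "\<And>B. B \<subseteq> pverts X \<Longrightarrow> separates (graph_dist X) (pverts X) B \<Longrightarrow> k \<le> card B"
  shows "metric_dimension X = k"
  unfolding metric_dimension_def
proof (rule Least_equality)
  obtain W where "set W = A" "distinct W"
    using finite_distinct_list[OF finite_subset[OF assms(2,1)]] by blast
  then show "\<exists>W. resolving_set X W \<and> length W = k"
    using assms(2-4) distinct_card[of W] by (intro exI[of _ W]) (simp add: resolving_set_iff)
next
  fix m assume "\<exists>W. resolving_set X W \<and> length W = m"
  then obtain W where "resolving_set X W" "length W = m" by blast
  then show "k \<le> m"
    using assms(5)[of "set W"] distinct_card[of W] by (simp add: resolving_set_iff)
qed

lemma adj_metric_dimension_le_card:
  assumes "finite (pverts X)" "A \<subseteq> pverts X" "separates (adj_dist X) (pverts X) A"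
  shows "adj_metric_dimension X \<le> card A"
    and "adj_metric_dimension X = card A \<Longrightarrow> \<exists>W. adj_basis X W \<and> set W = A"
proof -
  obtain W where W: "set W = A" "distinct W"
    using finite_distinct_list[OF finite_subset[OF assms(2,1)]] by blast
  then have res: "adj_resolving_set X W" and len: "length W = card A"
    using assms(2,3) distinct_card[of W] by (simp_all add: adj_resolving_set_iff)
  then show "adj_metric_dimension X \<le> card A"
    unfolding adj_metric_dimension_def by (intro Least_le) blast
  show "\<exists>W. adj_basis X W \<and> set W = A" if "adj_metric_dimension X = card A"
    using W res len that by (auto simp: adj_basis_def)
qed

section \<open>Classes of non-adjacent twins\<close>

context pair_graph
begin

text \<open>
  Without loops, the sets removed from the two neighbourhoods in the definition of twins only serve
  to ignore \<open>u\<close> and \<open>v\<close> themselves.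
\<close>

lemma twins_iff:
  "twins G u v \<longleftrightarrow>
     u \<noteq> v \<and> (\<forall>t. t \<noteq> u \<longrightarrow> t \<noteq> v \<longrightarrow> ((u, t) \<in> parcs G \<longleftrightarrow> (v, t) \<in> parcs G))"
proof -
  have "t \<notin> nbrs G t" for t
    using no_loops' unfolding nbrs_def by blast
  then show ?thesis
    unfolding twins_def nbrs_def set_eq_iff Diff_iff singleton_iff mem_Collect_eq by metis
qed

lemma equiv_twin_rel: "equiv (pverts G) (twin_rel G)"
proof (rule equivI)
  show "refl_on (pverts G) (twin_rel G)"
    by (auto simp: refl_on_def twin_rel_def)
  show "sym (twin_rel G)"
    by (auto simp: sym_def twin_rel_def twins_def)
  have "twins G x z" if "twins G x y" "twins G y z" "x \<noteq> z" for x y z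
  proof -
    have "(x, t) \<in> parcs G \<longleftrightarrow> (z, t) \<in> parcs G" if "t \<noteq> x" "t \<noteq> z" for t
    proof (cases "t = y")
      case False
      then show ?thesis
        using \<open>twins G x y\<close> \<open>twins G y z\<close> that unfolding twins_iff by simp
    next
      case True
      have "(x, z) \<in> parcs G \<longleftrightarrow> (y, z) \<in> parcs G" "(y, x) \<in> parcs G \<longleftrightarrow> (z, x) \<in> parcs G"
        using \<open>twins G x y\<close> \<open>twins G y z\<close> \<open>x \<noteq> z\<close> unfolding twins_iff by metis+
      then show ?thesis
        unfolding True using arcs_symmetric by blast
    qed
    then show ?thesis
      using \<open>x \<noteq> z\<close> unfolding twins_iff by blast
  qed
  then show "trans (twin_rel G)"
    unfolding trans_def twin_rel_def by blast
qed (auto simp: twin_rel_def)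

text \<open>
  A single non-adjacent pair of twins forces its whole class to be independent: a twin \<open>c\<close> of \<open>a\<close>
  adjacent to \<open>a\<close> would be adjacent to the non-adjacent twin \<open>b\<close> of \<open>a\<close>, and then \<open>a\<close>, being a twin of
  \<open>c\<close>, would be adjacent to \<open>b\<close>.
\<close>

lemma nonadjacent_twins_in_N_class:
  assumes "v \<in> pverts G" "v' \<in> pverts G" "twins G v v'" "(v, v') \<notin> parcs G"
  obtains C where "C \<in> N_classes G" "v \<in> C" "v' \<in> C"
proof
  let ?C = "twin_rel G `` {v}"
  have nonadj: "(a, c) \<notin> parcs G"
    if "twins G a b" "(a, b) \<notin> parcs G" "twins G a c" for a b c
  proof
    assume ac: "(a, c) \<in> parcs G"
    then have "c \<noteq> b" "c \<noteq> a" using that by (auto simp: twins_def)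
    then have "(b, c) \<in> parcs G"
      using ac that(1) unfolding twins_iff by simp
    then have "(c, b) \<in> parcs G" by (rule arcs_symmetric)
    then have "(a, b) \<in> parcs G"
      using \<open>twins G a c\<close> \<open>c \<noteq> b\<close> that(1) unfolding twins_iff by metis
    with that(2) show False ..
  qed
  have "(x, y) \<notin> parcs G" if "x \<in> ?C" "y \<in> ?C" for x y
  proof (cases "x = y")
    case True
    then show ?thesis using no_loops'[of x y] by argo
  next
    case False
    have "(x, y) \<in> twin_rel G"
      using quotient_eq_iff[OF equiv_twin_rel quotientI quotientI that] assms(1) by simp
    then have xy: "twins G x y" using False by (simp add: twin_rel_def)
    show ?thesis
    proof (cases "x = v")
      case True
      then show ?thesis using nonadj[of v v' y] assms(3,4) xy by simp
    next
      case False
      then have vx: "twins G v x" using that(1) by (auto simp: twin_rel_def)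
      then have "(v, x) \<notin> parcs G"
        using nonadj[of v v' x] assms(3,4) by simp
      then have "(x, v) \<notin> parcs G"
        using arcs_symmetric[of x v] by argo
      moreover have "twins G x v" using vx by (auto simp: twins_def)
      ultimately show ?thesis using nonadj[of x v y] xy by simp
    qed
  qed
  then have "independent G ?C" by (auto simp: independent_def)
  moreover show v: "v \<in> ?C" and v': "v' \<in> ?C" using assms by (auto simp: twin_rel_def)
  moreover have "finite ?C"
    by (rule finite_subset[OF _ pair_finite_verts]) (auto simp: twin_rel_def)
  then have "card {v, v'} \<le> card ?C" using v v' by (intro card_mono) auto
  then have "2 \<le> card ?C" using assms(3) by (simp add: twins_def)
  ultimately show "?C \<in> N_classes G"
    using assms(1) by (simp add: N_classes_def quotientI)
qed

lemma N_classD: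
  assumes "C \<in> N_classes G"
  shows "C \<subseteq> pverts G" "C \<noteq> {}"
    and "v \<in> C \<Longrightarrow> v' \<in> C \<Longrightarrow> v \<noteq> v' \<Longrightarrow> twins G v v'"
    and "v \<in> C \<Longrightarrow> v' \<in> C \<Longrightarrow> (v, v') \<notin> parcs G"
proof -
  have C: "C \<in> pverts G // twin_rel G" "independent G C" "card C \<ge> 2"
    using assms by (auto simp: N_classes_def)
  show "C \<subseteq> pverts G" using C(1) by (auto simp: quotient_def twin_rel_def)
  show "C \<noteq> {}" using C(3) by auto
  show "(v, v') \<notin> parcs G" if "v \<in> C" "v' \<in> C"
    using that C(2) by (simp add: independent_def)
  show "twins G v v'" if "v \<in> C" "v' \<in> C" "v \<noteq> v'"
    using quotient_eq_iff[OF equiv_twin_rel C(1) C(1) that(1,2)] that(3)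
    by (auto simp: twin_rel_def)
qed

lemma N_classes_disjoint:
  "C \<in> N_classes G \<Longrightarrow> D \<in> N_classes G \<Longrightarrow> v \<in> C \<Longrightarrow> v \<in> D \<Longrightarrow> C = D"
  using quotient_disj[OF equiv_twin_rel, of C D] by (auto simp: N_classes_def)

lemma finite_N_classes: "finite (N_classes G)" "finite (\<Union> (N_classes G))"
proof -
  show "finite (N_classes G)"
    by (rule finite_subset[of _ "Pow (pverts G)"]) (auto dest: N_classD(1) simp: pair_finite_verts)
  show "finite (\<Union> (N_classes G))"
    by (rule finite_subset[OF _ pair_finite_verts]) (auto dest: N_classD(1))
qed

text \<open>
  The next two lemmas say that \<open>b(G) - \<iota>\<^sub>N(G)\<close> is the least size of a set missing at most one vertex
  of each class of type (N). Such sets are the places where a resolving set of the product has to spend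
  an extra landmark.
\<close>

lemma ex_all_but_one_per_N_class:
  obtains E where "E \<subseteq> \<Union> (N_classes G)" "card E + iota_N G = b_num G"
    and "\<And>C v v'. C \<in> N_classes G \<Longrightarrow> v \<in> C \<Longrightarrow> v' \<in> C \<Longrightarrow> v \<notin> E \<Longrightarrow> v' \<notin> E \<Longrightarrow> v = v'"
proof -
  define r where "r C = (SOME v. v \<in> C)" for C :: "'a set"
  define R where "R = r ` N_classes G"
  have r: "r C \<in> C" if "C \<in> N_classes G" for C
    using N_classD(2)[OF that] unfolding r_def by (simp add: some_in_eq)
  have "inj_on r (N_classes G)"
  proof (rule inj_onI)
    fix C D assume "C \<in> N_classes G" "D \<in> N_classes G" "r C = r D"
    then show "C = D"
      using N_classes_disjoint[of C D "r C"] r[of C] r[of D] by simp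
  qed
  then have "card R = iota_N G" by (simp add: R_def iota_N_def card_image)
  moreover have R: "R \<subseteq> \<Union> (N_classes G)" using r by (auto simp: R_def)
  ultimately have card: "card (\<Union> (N_classes G) - R) + iota_N G = b_num G"
    using card_Diff_subset[of R "\<Union> (N_classes G)"] card_mono[OF finite_N_classes(2) R]
      finite_subset[OF R finite_N_classes(2)]
    by (simp add: b_num_def)
  have rep: "x = r C" if x: "C \<in> N_classes G" "x \<in> C" "x \<notin> \<Union> (N_classes G) - R" for C x
  proof -
    obtain D where "D \<in> N_classes G" "x = r D"
      using x by (auto simp: R_def)
    then show ?thesis
      using r[of D] N_classes_disjoint[of C D x] x(1,2) by simp
  qed
  show ?thesis
  proof (rule that[OF _ card])
    fix C v v'
    assume "C \<in> N_classes G" "v \<in> C" "v' \<in> C"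
      "v \<notin> \<Union> (N_classes G) - R" "v' \<notin> \<Union> (N_classes G) - R"
    then show "v = v'" using rep[of C v] rep[of C v'] by simp
  qed blast
qed

lemma card_ge_if_all_but_one_per_N_class:
  assumes "finite E"
    and "\<And>C v v'. C \<in> N_classes G \<Longrightarrow> v \<in> C \<Longrightarrow> v' \<in> C \<Longrightarrow> v \<notin> E \<Longrightarrow> v' \<notin> E \<Longrightarrow> v = v'"
  shows "b_num G \<le> card E + iota_N G"
proof -
  let ?M = "\<Union> (N_classes G) - E"
  \<comment> \<open>Sending a missed vertex to its class is injective, so at most \<open>\<iota>\<^sub>N(G)\<close> vertices are missed.\<close>
  define cl where "cl v = (SOME C. C \<in> N_classes G \<and> v \<in> C)" for v
  have cl: "cl v \<in> N_classes G \<and> v \<in> cl v" if "v \<in> ?M" for v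
    using that unfolding cl_def by - (rule someI_ex, blast)
  have "inj_on cl ?M"
  proof (rule inj_onI)
    fix v v' assume "v \<in> ?M" "v' \<in> ?M" "cl v = cl v'"
    then show "v = v'"
      using cl[of v] cl[of v'] assms(2)[of "cl v" v v'] by simp
  qed
  then have "card ?M \<le> iota_N G"
    unfolding iota_N_def using cl finite_N_classes(1) by (intro card_inj_on_le) auto
  moreover have "b_num G \<le> card (?M \<union> E)"
    unfolding b_num_def by (rule card_mono) (use finite_N_classes(2) assms(1) in auto)
  moreover have "card (?M \<union> E) \<le> card ?M + card E" by (rule card_Un_le)
  ultimately show ?thesis by simp
qed

end

section \<open>Resolving sets of lexicographic products\<close>

text \<open>
  Connectedness of \<open>G\<close> enters only through the absence of isolated vertices: a neighbour of \<open>v\<close> bounds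
  distances within the layer of \<open>v\<close> by 2. The bound on the order of \<open>H\<close> ensures that an adjacency
  resolving set of \<open>H\<close> is nonempty, so that every layer contains a landmark.
\<close>

locale lex_product_factors = G: pair_graph G + H: pair_graph H
  for G :: "'a pair_pre_digraph" and H :: "'b pair_pre_digraph" +
  assumes ex_neighbour: "v \<in> pverts G \<Longrightarrow> \<exists>w. (v, w) \<in> parcs G"
    and card_H: "card (pverts H) \<ge> 2"
begin

abbreviation "L \<equiv> lex_product G H"

lemma pverts_L: "pverts L = pverts G \<times> pverts H"
  by (simp add: lex_product_def)

lemma parcs_L_iff:
  "((v, u), (v', u')) \<in> parcs L \<longleftrightarrow> u \<in> pverts H \<and> u' \<in> pverts H \<and>
     ((v, v') \<in> parcs G \<or> v \<in> pverts G \<and> v = v' \<and> (u, u') \<in> parcs H)"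
  by (auto simp: lex_product_def dest: G.in_arcsD1 G.in_arcsD2)

sublocale L: pair_wf_digraph L
  by unfold_locales (auto simp: lex_product_def)

lemma no_loop_G: "(v, v) \<notin> parcs G"
  using G.pair_no_loops by fastforce

lemma graph_dist_same_layer:
  assumes "v \<in> pverts G" "u \<in> pverts H" "u' \<in> pverts H"
  shows "graph_dist L (v, u) (v, u') = ereal (adj_dist H u u')"
proof -
  obtain t where "(v, t) \<in> parcs G" using ex_neighbour assms(1) by blast
  then have "((v, u), (t, u)) \<in> parcs L" "((t, u), (v, u')) \<in> parcs L"
    using assms by (auto simp: parcs_L_iff dest: G.arcs_symmetric)
  moreover have "adj_dist L (v, u) (v, u') = adj_dist H u u'"
    using assms no_loop_G by (auto simp: adj_dist_def parcs_L_iff)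
  ultimately show ?thesis
    using L.graph_dist_eq_adj_dist[of "(v, u)" "(v, u')"] assms by (auto simp: pverts_L)
qed

lemma graph_dist_other_layer:
  assumes "v \<in> pverts G" "u \<in> pverts H" "u' \<in> pverts H" "fst w \<noteq> v"
  shows "graph_dist L (v, u) w = graph_dist L (v, u') w"
  by (rule L.graph_dist_module[where S = "{v} \<times> pverts H"])
    (use assms in \<open>auto simp: parcs_L_iff\<close>)

lemma graph_dist_twin_layers:
  assumes "twins G v v'" "v \<in> pverts G" "v' \<in> pverts G" "u \<in> pverts H" "u' \<in> pverts H"
    and "fst w \<noteq> v" "fst w \<noteq> v'"
  shows "graph_dist L (v, u) w = graph_dist L (v', u') w"
proof (rule L.graph_dist_module[where S = "{v, v'} \<times> pverts H"])
  fix x y z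
  assume "x \<in> {v, v'} \<times> pverts H" "y \<in> {v, v'} \<times> pverts H" "z \<notin> {v, v'} \<times> pverts H"
    and "(x, z) \<in> parcs L"
  then show "(y, z) \<in> parcs L"
    using assms(1)[unfolded G.twins_iff]
    by (cases x; cases y; cases z) (auto simp: parcs_L_iff)
qed (use assms in auto)

lemma graph_dist_between_twin_layers:
  assumes "twins G v v'" "v \<in> pverts G" "v' \<in> pverts G" "u \<in> pverts H" "u' \<in> pverts H"
  shows "graph_dist L (v, u) (v', u') = ereal (adj_dist G v v')"
proof -
  have "v \<noteq> v'" using assms(1) by (simp add: twins_def)
  then have eq: "adj_dist L (v, u) (v', u') = adj_dist G v v'"
    using assms by (auto simp: adj_dist_def parcs_L_iff)
  have "\<exists>z. ((v, u), z) \<in> parcs L \<and> (z, (v', u')) \<in> parcs L" if "(v, v') \<notin> parcs G"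
  proof -
    obtain t where t: "(v, t) \<in> parcs G" using ex_neighbour assms(2) by blast
    then have "t \<noteq> v" "t \<noteq> v'" using that no_loop_G by auto
    then have "(v', t) \<in> parcs G" using t assms(1)[unfolded G.twins_iff] by blast
    then show ?thesis
      using t assms by (intro exI[of _ "(t, u)"]) (auto simp: parcs_L_iff dest: G.arcs_symmetric)
  qed
  then show ?thesis
    using L.graph_dist_eq_adj_dist[of "(v, u)" "(v', u')"] assms
    unfolding eq by (auto simp: pverts_L parcs_L_iff)
qed

text \<open>
  The constant \<open>adj_dist G v v'\<close>, which is 1 for adjacent and 2 for non-adjacent twins, is the distance
  between any two points in the layers of \<open>v\<close> and \<open>v'\<close>. A pair \<open>(v, u)\<close>, \<open>(v', u')\<close> stays unseparated
  when \<open>u\<close> sees all landmarks of its own layer at that same distance, and \<open>u'\<close> does so in its layer.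
\<close>

lemma separates_lex_product_iff:
  assumes A: "A \<subseteq> pverts L"
  shows "separates (graph_dist L) (pverts L) A \<longleftrightarrow>
    (\<forall>v\<in>pverts G. separates (adj_dist H) (pverts H) (A `` {v})) \<and>
    (\<forall>v\<in>pverts G. \<forall>v'\<in>pverts G. twins G v v' \<longrightarrow>
       \<not> ((\<exists>u\<in>pverts H. \<forall>w\<in>A `` {v}. adj_dist H u w = adj_dist G v v') \<and>
          (\<exists>u\<in>pverts H. \<forall>w\<in>A `` {v'}. adj_dist H u w = adj_dist G v v')))"
    (is "?sep \<longleftrightarrow> ?layers \<and> ?twins")
proof (intro iffI conjI)
  assume sep: ?sep
  show ?layers
  proof
    fix v assume v: "v \<in> pverts G"
    have "u = u'"
      if u: "u \<in> pverts H" "u' \<in> pverts H"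
        and eq: "\<And>w. w \<in> A `` {v} \<Longrightarrow> adj_dist H u w = adj_dist H u' w" for u u'
    proof -
      have "graph_dist L (v, u) w = graph_dist L (v, u') w" if "w \<in> A" for w
      proof (cases "fst w = v")
        case True
        then show ?thesis
          using \<open>w \<in> A\<close> A u v eq
          by (cases w) (auto simp: graph_dist_same_layer pverts_L)
      next
        case False
        then show ?thesis
          using graph_dist_other_layer v u by blast
      qed
      then have "(v, u) = (v, u')"
        using v u by (intro separatesD[OF sep]) (auto simp: pverts_L)
      then show ?thesis by simp
    qed
    then show "separates (adj_dist H) (pverts H) (A `` {v})"
      unfolding separates_def by blast
  qed
  show ?twins
  proof (intro ballI impI notI)
    fix v v' assume v: "v \<in> pverts G" "v' \<in> pverts G" and tw: "twins G v v'"
      and "(\<exists>u\<in>pverts H. \<forall>w\<in>A `` {v}. adj_dist H u w = adj_dist G v v') \<and>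
          (\<exists>u\<in>pverts H. \<forall>w\<in>A `` {v'}. adj_dist H u w = adj_dist G v v')"
    then obtain u u' where u: "u \<in> pverts H" "u' \<in> pverts H"
      and eq: "\<And>w. (v, w) \<in> A \<Longrightarrow> adj_dist H u w = adj_dist G v v'"
        "\<And>w. (v', w) \<in> A \<Longrightarrow> adj_dist H u' w = adj_dist G v v'"
      by blast
    have tw': "twins G v' v" using tw by (auto simp: twins_def)
    have comm: "adj_dist G v' v = adj_dist G v v'"
      by (rule adj_dist_commute[OF G.pair_graph])
    have "graph_dist L (v, u) (t, s) = graph_dist L (v', u') (t, s)" if "(t, s) \<in> A" for t s
    proof -
      have s: "s \<in> pverts H" using that A by (auto simp: pverts_L)
      consider "t = v" | "t = v'" | "t \<noteq> v" "t \<noteq> v'" by blast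
      then show ?thesis
      proof cases
        case 1
        then show ?thesis
          using that v u s eq(1) comm
          by (simp add: graph_dist_same_layer graph_dist_between_twin_layers[OF tw'])
      next
        case 2
        then show ?thesis
          using that v u s eq(2)
          by (simp add: graph_dist_same_layer graph_dist_between_twin_layers[OF tw])
      next
        case 3
        then show ?thesis
          using v u by (intro graph_dist_twin_layers[OF tw]) auto
      qed
    qed
    then have "(v, u) = (v', u')"
      using v u by (intro separatesD[OF sep]) (auto simp: pverts_L)
    then show False using tw by (simp add: twins_def)
  qed
next
  assume "?layers \<and> ?twins"
  then have layers: "\<And>v. v \<in> pverts G \<Longrightarrow> separates (adj_dist H) (pverts H) (A `` {v})"
    and twins: ?twins
    by auto
  have nonempty: "A `` {v} \<noteq> {}" if "v \<in> pverts G" for v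
  proof
    assume "A `` {v} = {}"
    then have "u = u'" if "u \<in> pverts H" "u' \<in> pverts H" for u u'
      using separatesD[OF layers[OF \<open>v \<in> pverts G\<close>] that] by blast
    then have "card (pverts H) \<le> 1"
      using H.pair_finite_verts by (auto simp: card_le_Suc0_iff_eq)
    then show False using card_H by simp
  qed
  have "(v, u) = (v', u')"
    if v: "v \<in> pverts G" "v' \<in> pverts G" and u: "u \<in> pverts H" "u' \<in> pverts H"
      and eq: "\<And>w. w \<in> A \<Longrightarrow> graph_dist L (v, u) w = graph_dist L (v', u') w" for v v' u u'
  proof (cases "v = v'")
    case True
    have "adj_dist H u w = adj_dist H u' w" if "w \<in> A `` {v}" for w
      using eq[of "(v, w)"] that v u A True by (auto simp: graph_dist_same_layer pverts_L)
    then show ?thesis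
      using separatesD[OF layers[OF v(1)] u] True by blast
  next
    case False
    \<comment> \<open>A landmark in the layer of \<open>t\<close> detects adjacency to \<open>t\<close> as distance 1.\<close>
    have "(v, t) \<in> parcs G \<longleftrightarrow> (v', t) \<in> parcs G" if t: "t \<noteq> v" "t \<noteq> v'" for t
    proof (cases "t \<in> pverts G")
      case True
      then obtain s where s: "(t, s) \<in> A" using nonempty by blast
      then have "s \<in> pverts H" using A by (auto simp: pverts_L)
      then show ?thesis
        using eq[OF s] L.graph_dist_eq_1_iff[of "(v, u)" "(t, s)"]
          L.graph_dist_eq_1_iff[of "(v', u')" "(t, s)"] t u
        by (auto simp: parcs_L_iff)
    next
      case False
      then show ?thesis using G.in_arcsD2 by blast
    qed
    then have tw: "twins G v v'"
      using False by (simp add: G.twins_iff)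
    have tw': "twins G v' v" using tw by (auto simp: twins_def)
    have comm: "adj_dist G v' v = adj_dist G v v'"
      by (rule adj_dist_commute[OF G.pair_graph])
    have "adj_dist H u w = adj_dist G v v'" if "w \<in> A `` {v}" for w
      using eq[of "(v, w)"] that v u A comm
      by (auto simp: graph_dist_same_layer graph_dist_between_twin_layers[OF tw'] pverts_L)
    moreover have "adj_dist H u' w = adj_dist G v v'" if "w \<in> A `` {v'}" for w
      using eq[of "(v', w)"] that v u A
      by (auto simp: graph_dist_same_layer graph_dist_between_twin_layers[OF tw] pverts_L)
    ultimately show ?thesis using twins v u tw by blast
  qed
  then show ?sep
    unfolding separates_def pverts_L by blast
qed

lemma card_eq_sum_layers:
  assumes "A \<subseteq> pverts L"
  shows "card A = (\<Sum>v\<in>pverts G. card (A `` {v}))"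
proof -
  have "A = Sigma (pverts G) (\<lambda>v. A `` {v})"
    using assms by (auto simp: pverts_L)
  moreover have "finite (A `` {v})" for v
    using assms by (intro finite_subset[OF _ H.pair_finite_verts]) (auto simp: pverts_L)
  ultimately show ?thesis
    using card_SigmaI[of "pverts G" "\<lambda>v. A `` {v}"] G.pair_finite_verts by simp
qed

end

section \<open>The metric dimension\<close>

text \<open>
  Stated additively so that all quantities are natural numbers without truncated subtraction.
\<close>

lemma (in lex_product_factors) metric_dimension_lex_product:
  assumes ent2: "\<And>W. adj_basis H W \<Longrightarrow> \<exists>v\<in>pverts H. entirely 2 (adj_rep H v W)"
    and W: "adj_basis H W" "\<not> (\<exists>v\<in>pverts H. entirely 1 (adj_rep H v W))"
  shows "metric_dimension L + iota_N G = card (pverts G) * adj_metric_dimension H + b_num G"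
proof -
  define \<beta> where "\<beta> = adj_metric_dimension H"
  define W0 where "W0 = set W"
  have W0: "W0 \<subseteq> pverts H" "separates (adj_dist H) (pverts H) W0" "card W0 = \<beta>"
    using W(1) distinct_card[of W]
    by (auto simp: adj_basis_def adj_resolving_set_iff W0_def \<beta>_def)
  have no1: "\<not> (\<forall>w\<in>W0. adj_dist H u w = 1)" if "u \<in> pverts H" for u
    using W(2) that by (auto simp: entirely_adj_rep_iff W0_def)
  obtain z where z: "z \<in> pverts H" "\<forall>w\<in>W0. adj_dist H z w = 2"
    using ent2[OF W(1)] by (auto simp: entirely_adj_rep_iff W0_def)
  have "z \<notin> W0" using z(2) by (auto simp: adj_dist_def)
  define W1 where "W1 = insert z W0"
  have finW0: "finite W0" by (simp add: W0_def)
  have W1: "W1 \<subseteq> pverts H" "separates (adj_dist H) (pverts H) W1" "card W1 = Suc \<beta>"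
    using W0 z(1) \<open>z \<notin> W0\<close> finW0 separates_mono[of "adj_dist H" "pverts H" W0 W1]
    by (auto simp: W1_def)
  have no2: "\<not> (\<forall>w\<in>W1. adj_dist H u w = 2)" if "u \<in> pverts H" for u
  proof
    assume u: "\<forall>w\<in>W1. adj_dist H u w = 2"
    then have "u = z"
      using that z by (intro separatesD[OF W0(2)]) (auto simp: W1_def)
    then show False using u by (simp add: W1_def adj_dist_def)
  qed
  obtain E where E: "E \<subseteq> \<Union> (N_classes G)" "card E + iota_N G = b_num G"
    and E_class: "\<And>C v v'. C \<in> N_classes G \<Longrightarrow> v \<in> C \<Longrightarrow> v' \<in> C \<Longrightarrow> v \<notin> E \<Longrightarrow> v' \<notin> E \<Longrightarrow> v = v'"
    by (rule G.ex_all_but_one_per_N_class) (rule that)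
  have EG: "E \<subseteq> pverts G" using E(1) G.N_classD(1) by blast
  define A where "A = Sigma (pverts G) (\<lambda>v. if v \<in> E then W1 else W0)"
  have AL: "A \<subseteq> pverts L" using W0 W1 by (auto simp: A_def pverts_L split: if_splits)
  have layer: "A `` {v} = (if v \<in> E then W1 else W0)" if "v \<in> pverts G" for v
    using that by (auto simp: A_def)
  have "metric_dimension L = card (pverts G) * \<beta> + card E"
  proof (rule metric_dimension_eqI[OF _ AL])
    show "finite (pverts L)"
      using G.pair_finite_verts H.pair_finite_verts by (simp add: pverts_L)
    have "\<not> ((\<exists>u\<in>pverts H. \<forall>w\<in>A `` {v}. adj_dist H u w = adj_dist G v v') \<and>
             (\<exists>u\<in>pverts H. \<forall>w\<in>A `` {v'}. adj_dist H u w = adj_dist G v v'))"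
      if v: "v \<in> pverts G" "v' \<in> pverts G" and tw: "twins G v v'" for v v'
    proof (cases "(v, v') \<in> parcs G")
      case True
      then have "adj_dist G v v' = 1" using tw by (simp add: adj_dist_def twins_def)
      then show ?thesis
        using no1 layer[OF v(1)] by (auto simp: W1_def)
    next
      case False
      then have two: "adj_dist G v v' = 2" using tw by (simp add: adj_dist_def twins_def)
      obtain C where "C \<in> N_classes G" "v \<in> C" "v' \<in> C"
        using G.nonadjacent_twins_in_N_class[OF v tw False] .
      then have "v \<in> E \<or> v' \<in> E"
        using E_class[of C v v'] tw by (auto simp: twins_def)
      then show ?thesis
        using no2 layer v two by auto
    qed
    then show "separates (graph_dist L) (pverts L) A"
      using W0 W1 layer by (auto simp: separates_lex_product_iff[OF AL])
    have "card A = (\<Sum>v\<in>pverts G. \<beta> + of_bool (v \<in> E))"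
      unfolding card_eq_sum_layers[OF AL]
      using W0 W1 layer by (intro sum.cong) auto
    also have "\<dots> = card (pverts G) * \<beta> + card E"
      using EG G.pair_finite_verts by (simp add: sum.distrib Int_absorb1)
    finally show "card A = card (pverts G) * \<beta> + card E" .
  next
    fix B assume BL: "B \<subseteq> pverts L" and sep: "separates (graph_dist L) (pverts L) B"
    note iff = sep[unfolded separates_lex_product_iff[OF BL]]
    \<comment> \<open>Layers whose slice is not an adjacency basis, hence has at least one landmark more.\<close>
    define F where "F = {v \<in> pverts G. card (B `` {v}) \<noteq> \<beta>}"
    have BH: "B `` {v} \<subseteq> pverts H" for v using BL by (auto simp: pverts_L)
    have ge: "\<beta> \<le> card (B `` {v})" if "v \<in> pverts G" for v
      unfolding \<beta>_def using iff that
      by (intro adj_metric_dimension_le_card(1)[OF H.pair_finite_verts BH]) auto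
    have all2: "\<exists>u\<in>pverts H. \<forall>w\<in>B `` {v}. adj_dist H u w = 2"
      if v: "v \<in> pverts G" "v \<notin> F" for v
    proof -
      have "adj_metric_dimension H = card (B `` {v})"
        using v by (simp add: F_def \<beta>_def)
      then obtain W' where "adj_basis H W'" "set W' = B `` {v}"
        using adj_metric_dimension_le_card(2)[OF H.pair_finite_verts BH, of v] iff v(1)
        by blast
      then show ?thesis using ent2 by (metis entirely_adj_rep_iff)
    qed
    have "v = v'"
      if C: "C \<in> N_classes G" "v \<in> C" "v' \<in> C" and "v \<notin> F" "v' \<notin> F" for C v v'
    proof (rule ccontr)
      assume "v \<noteq> v'"
      then have tw: "twins G v v'" and two: "adj_dist G v v' = 2"
        using G.N_classD[OF C(1)] C(2,3) by (auto simp: adj_dist_def)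
      have v: "v \<in> pverts G" "v' \<in> pverts G" using G.N_classD(1)[OF C(1)] C(2,3) by auto
      show False
        using conjunct2[OF iff, rule_format, OF v tw, unfolded two]
          all2[OF v(1) \<open>v \<notin> F\<close>] all2[OF v(2) \<open>v' \<notin> F\<close>] by blast
    qed
    then have "b_num G \<le> card F + iota_N G"
      using G.pair_finite_verts
      by (intro G.card_ge_if_all_but_one_per_N_class) (auto simp: F_def)
    moreover have "card (pverts G) * \<beta> + card F \<le> card B"
    proof -
      have "card (pverts G) * \<beta> + card F = (\<Sum>v\<in>pverts G. \<beta> + of_bool (v \<in> F))"
        using G.pair_finite_verts by (simp add: sum.distrib F_def Int_def conj_commute)
      also have "\<dots> \<le> (\<Sum>v\<in>pverts G. card (B `` {v}))"
        using ge by (intro sum_mono) (force simp: F_def)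
      finally show ?thesis unfolding card_eq_sum_layers[OF BL] .
    qed
    ultimately show "card (pverts G) * \<beta> + card E \<le> card B" using E(2) by simp
  qed
  then show ?thesis using E(2) by (simp add: \<beta>_def)
qed

theorem theorem4:
  fixes G :: "'a pair_pre_digraph" and H :: "'b pair_pre_digraph" and n :: nat
  assumes "pair_graph G" and "Digraph_Component.connected (with_proj G)"
    and "card (pverts G) = n" and "n \<ge> 2"
    and "pair_graph H" and "card (pverts H) \<ge> 2"
    and "\<forall>W. adj_basis H W \<longrightarrow> (\<exists>v \<in> pverts H. entirely 2 (adj_rep H v W))"
    and "\<exists>W. adj_basis H W \<and> \<not> (\<exists>v \<in> pverts H. entirely 1 (adj_rep H v W))"
  shows "int (metric_dimension (lex_product G H)) =
           int n * int (adj_metric_dimension H) + int (b_num G) - int (iota_N G)"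
proof -
  interpret G: pair_graph G by fact
  interpret H: pair_graph H by fact
  interpret lex_product_factors G H
    using ex_neighbour_if_connected assms(1-4,6) by unfold_locales auto
  obtain W where "adj_basis H W" "\<not> (\<exists>v \<in> pverts H. entirely 1 (adj_rep H v W))"
    using assms(8) by blast
  then have "metric_dimension L + iota_N G = n * adj_metric_dimension H + b_num G"
    using metric_dimension_lex_product assms(3,7) by blast
  then have "int (metric_dimension L + iota_N G) = int (n * adj_metric_dimension H + b_num G)"
    by (rule arg_cong)
  then show ?thesis by simp
qed

end
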